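(* Let $u_L(x_t)=\Gamma_0x(t)+\int_{-h}^0\Gamma_1(\theta)x(t+\theta)\,d\theta$ be an admissible linear control for the system $$\dot{x}(t)=Ax(t)+Bx(t-h)+\int_{-h}^{0}E(\theta)x(t+\theta)\,d\theta+Du(t),\qquad t\ge0,$$ so that the closed-loop system $$\dot{x}(t)=A_{0}x(t)+A_{1}x(t-h)+\int_{-h}^{0}G(\theta)x(t+\theta)\,d\theta,\qquad t\ge0,$$ with $A_0=A+D\Gamma_0$, $A_1=B$, $G(\theta)=E(\theta)+D\Gamma_1(\theta)$, is exponentially stable. Then the Bellman functional $$V(\varphi)=J(\varphi,u_L)=\int_0^\infty\left(x^T(t)Qx(t)+u_L^T(t)Ru_L(t)\right)dt=\varphi^{T}(0)\Pi_{0}\varphi(0)+2\varphi^{T}(0)\int_{-h}^{0}\Pi_{1}(\theta)\varphi(\theta)\,d\theta+\int_{-h}^{0}\int_{-h}^{0}\varphi^{T}(\xi)\Pi_{2}(\xi,\theta)\varphi(\theta)\,d\xi\,d\theta$$ admits a quadratic upper bound and a local cubic lower bound, that is: (1) there exists $C_1>0$ such that $V(\varphi)\le C_1\|\varphi\|_h^2$ for all $\varphi\in\mathrm{PC}([-h,0],\mathbb{R}^n)$; (2) there exist $\alpha>0$ and $c>0$ such that $V(\varphi)\ge c\,\|\varphi(0)\|^3$ for all $\varphi\in\mathrm{PC}([-h,0],\mathbb{R}^n)$ with $\|\varphi\|_h\le\alpha$.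
   Context: Here $h>0$; $A,B\in\mathbb{R}^{n\times n}$ and $D\in\mathbb{R}^{n\times r}$ ($r\le n$) are constant; $E(\theta)\in\mathbb{R}^{n\times n}$ is continuous on $[-h,0]$; $Q\in\mathbb{R}^{n\times n}$ and $R\in\mathbb{R}^{r\times r}$ are symmetric positive definite; $\Gamma_0\in\mathbb{R}^{r\times n}$ is constant and $\Gamma_1$ is an $r\times n$ matrix function on $[-h,0]$ (such that the integrals involving it are defined). $\mathrm{PC}([-h,0],\mathbb{R}^n)$ is the space of piecewise continuous functions $\varphi:[-h,0]\to\mathbb{R}^n$ with norm $\|\varphi\|_h=\sup_{\theta\in[-h,0]}\|\varphi(\theta)\|$, where $\|\cdot\|$ is the Euclidean norm; $x(t)$ is the closed-loop solution with initial function $\varphi$ and $x_t=\{x(t+\theta):\theta\in[-h,0]\}$. A control $u$ is admissible if: (1) $u=u(x_t)$ is a function of the state $x_t$; (2) solutions of the closed-loop system exist and are unique for $t\ge0$ and all initial conditions; (3) the trivial solution of the closed-loop system is asymptotically stable; (4) for all initial conditions the value of $J$ is finite. The functional $V$ is represented in the displayed three-term form with a symmetric positive definite matrix $\Pi_0$, a matrix function $\Pi_1$ on $[-h,0]$ and a matrix function $\Pi_2$ on $[-h,0]^2$ with $\Pi_2^T(\xi,\theta)=\Pi_2(\theta,\xi)$. When $u_L$ is the optimal control, $V$ is the Bellman functional (optimal value) of the problem of minimizing $J$. *)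

theory Defs
  imports "HOL-Analysis.Analysis"
begin

definition sym_pos_def :: "real^'m^'m \<Rightarrow> bool" where
  "sym_pos_def M \<longleftrightarrow> transpose M = M \<and> (\<forall>x. x \<noteq> 0 \<longrightarrow> x \<bullet> (M *v x) > 0)"

text \<open>Functions on an interval are total functions on the reals, and only their values on the
  interval matter. The value of a piecewise continuous function at a jump is arbitrary.\<close>

definition PC :: "real \<Rightarrow> (real \<Rightarrow> 'a::real_normed_vector) set" where
  "PC h = {\<phi>. \<exists>S. finite S \<and> continuous_on ({-h..0} - S) \<phi> \<and>
      (\<forall>s\<in>S \<inter> {-h<..0}. \<exists>l. (\<phi> \<longlongrightarrow> l) (at_left s)) \<and>
      (\<forall>s\<in>S \<inter> {-h..<0}. \<exists>l. (\<phi> \<longlongrightarrow> l) (at_right s))}"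

definition norm_h :: "real \<Rightarrow> (real \<Rightarrow> 'a::real_normed_vector) \<Rightarrow> real" where
  "norm_h h \<phi> = (SUP \<theta>\<in>{-h..0}. norm (\<phi> \<theta>))"

text \<open>The restriction makes every functional of the state depend on the values
  of \<open>x\<close> on \<open>[t - h, t]\<close> only.\<close>

definition state :: "real \<Rightarrow> (real \<Rightarrow> 'a) \<Rightarrow> real \<Rightarrow> real \<Rightarrow> 'a" where
  "state h x t = (\<lambda>\<theta>\<in>{-h..0}. x (t + \<theta>))"

text \<open>Solutions on \<open>[-h, \<infinity>)\<close> of \<open>x'(t) = F(x\<^sub>t)\<close>, \<open>t \<ge> 0\<close>, with initial function \<open>\<phi>\<close>.
  A jump of \<open>\<phi>\<close> at \<open>\<theta>\<close> in general destroys differentiability at \<open>t = \<theta> + h\<close>; hence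
  \<open>x\<close> is continuous for \<open>t \<ge> 0\<close> and the equation holds off a locally finite set.\<close>

definition is_solution ::
  "real \<Rightarrow> ((real \<Rightarrow> 'a::real_normed_vector) \<Rightarrow> 'a) \<Rightarrow> (real \<Rightarrow> 'a) \<Rightarrow> (real \<Rightarrow> 'a) \<Rightarrow> bool" where
  "is_solution h F \<phi> x \<longleftrightarrow>
     (\<forall>\<theta>\<in>{-h..0}. x \<theta> = \<phi> \<theta>) \<and> continuous_on {0..} x \<and>
     (\<exists>S. (\<forall>T. finite (S \<inter> {0..T})) \<and>
        (\<forall>t\<in>{0..} - S. (x has_vector_derivative F (state h x t)) (at t within {0..})))"

definition well_posed :: "real \<Rightarrow> ((real \<Rightarrow> 'a::real_normed_vector) \<Rightarrow> 'a) \<Rightarrow> bool" where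
  "well_posed h F \<longleftrightarrow>
     (\<forall>\<phi>\<in>PC h. \<exists>x. is_solution h F \<phi> x \<and>
        (\<forall>y. is_solution h F \<phi> y \<longrightarrow> (\<forall>t\<ge>-h. y t = x t)))"

definition asymptotically_stable ::
  "real \<Rightarrow> ((real \<Rightarrow> 'a::real_normed_vector) \<Rightarrow> 'a) \<Rightarrow> bool" where
  "asymptotically_stable h F \<longleftrightarrow>
     is_solution h F (\<lambda>_. 0) (\<lambda>_. 0) \<and>
     (\<forall>\<epsilon>>0. \<exists>\<delta>>0. \<forall>\<phi>\<in>PC h. norm_h h \<phi> < \<delta> \<longrightarrow>
        (\<forall>x. is_solution h F \<phi> x \<longrightarrow> (\<forall>t\<ge>0. norm (x t) < \<epsilon>))) \<and>
     (\<exists>\<delta>>0. \<forall>\<phi>\<in>PC h. norm_h h \<phi> < \<delta> \<longrightarrow>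
        (\<forall>x. is_solution h F \<phi> x \<longrightarrow> (x \<longlongrightarrow> 0) at_top))"

definition exponentially_stable ::
  "real \<Rightarrow> ((real \<Rightarrow> 'a::real_normed_vector) \<Rightarrow> 'a) \<Rightarrow> bool" where
  "exponentially_stable h F \<longleftrightarrow>
     (\<exists>\<gamma>>0. \<exists>\<sigma>>0. \<forall>\<phi>\<in>PC h. \<forall>x. is_solution h F \<phi> x \<longrightarrow>
        (\<forall>t\<ge>0. norm (x t) \<le> \<gamma> * exp (- \<sigma> * t) * norm_h h \<phi>))"

definition delay_rhs ::
  "real \<Rightarrow> real^'n^'n \<Rightarrow> real^'n^'n \<Rightarrow> (real \<Rightarrow> real^'n^'n) \<Rightarrow> (real \<Rightarrow> real^'n) \<Rightarrow> real^'n" where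
  "delay_rhs h A0 A1 G \<psi> =
     A0 *v \<psi> 0 + A1 *v \<psi> (-h) + integral {-h..0} (\<lambda>\<theta>. G \<theta> *v \<psi> \<theta>)"

definition closed_loop ::
  "real \<Rightarrow> real^'n^'n \<Rightarrow> real^'n^'n \<Rightarrow> (real \<Rightarrow> real^'n^'n) \<Rightarrow> real^'r^'n \<Rightarrow>
   ((real \<Rightarrow> real^'n) \<Rightarrow> real^'r) \<Rightarrow> (real \<Rightarrow> real^'n) \<Rightarrow> real^'n" where
  "closed_loop h A B E D u \<psi> = delay_rhs h A B E \<psi> + D *v u \<psi>"

definition linear_control ::
  "real \<Rightarrow> real^'n^'r \<Rightarrow> (real \<Rightarrow> real^'n^'r) \<Rightarrow> (real \<Rightarrow> real^'n) \<Rightarrow> real^'r" where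
  "linear_control h \<Gamma>0 \<Gamma>1 \<psi> = \<Gamma>0 *v \<psi> 0 + integral {-h..0} (\<lambda>\<theta>. \<Gamma>1 \<theta> *v \<psi> \<theta>)"

definition running_cost ::
  "real \<Rightarrow> real^'n^'n \<Rightarrow> real^'r^'r \<Rightarrow> ((real \<Rightarrow> real^'n) \<Rightarrow> real^'r) \<Rightarrow>
   (real \<Rightarrow> real^'n) \<Rightarrow> real \<Rightarrow> real" where
  "running_cost h Q R u x t =
     x t \<bullet> (Q *v x t) + u (state h x t) \<bullet> (R *v u (state h x t))"

text \<open>Meaningful for well-posed closed-loop systems, where the choice of the solution is
  immaterial.\<close>

definition cost ::
  "real \<Rightarrow> real^'n^'n \<Rightarrow> real^'n^'n \<Rightarrow> (real \<Rightarrow> real^'n^'n) \<Rightarrow> real^'r^'n \<Rightarrow>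
   real^'n^'n \<Rightarrow> real^'r^'r \<Rightarrow> (real \<Rightarrow> real^'n) \<Rightarrow> ((real \<Rightarrow> real^'n) \<Rightarrow> real^'r) \<Rightarrow> real" where
  "cost h A B E D Q R \<phi> u =
     integral {0..} (running_cost h Q R u (SOME x. is_solution h (closed_loop h A B E D u) \<phi> x))"

text \<open>That the control is a function of the state is built into its type. For positive
  definite \<open>Q\<close> and \<open>R\<close> the running cost is nonnegative, so integrability on \<open>[0, \<infinity>)\<close> is
  finiteness of the cost.\<close>

definition admissible ::
  "real \<Rightarrow> real^'n^'n \<Rightarrow> real^'n^'n \<Rightarrow> (real \<Rightarrow> real^'n^'n) \<Rightarrow> real^'r^'n \<Rightarrow>
   real^'n^'n \<Rightarrow> real^'r^'r \<Rightarrow> ((real \<Rightarrow> real^'n) \<Rightarrow> real^'r) \<Rightarrow> bool" where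
  "admissible h A B E D Q R u \<longleftrightarrow>
     well_posed h (closed_loop h A B E D u) \<and>
     asymptotically_stable h (closed_loop h A B E D u) \<and>
     (\<forall>\<phi>\<in>PC h. \<forall>x. is_solution h (closed_loop h A B E D u) \<phi> x \<longrightarrow>
        running_cost h Q R u x integrable_on {0..})"

definition quadratic_functional ::
  "real \<Rightarrow> real^'n^'n \<Rightarrow> (real \<Rightarrow> real^'n^'n) \<Rightarrow> (real \<Rightarrow> real \<Rightarrow> real^'n^'n) \<Rightarrow>
   (real \<Rightarrow> real^'n) \<Rightarrow> real" where
  "quadratic_functional h \<Pi>0 \<Pi>1 \<Pi>2 \<phi> =
     \<phi> 0 \<bullet> (\<Pi>0 *v \<phi> 0)
     + 2 * (\<phi> 0 \<bullet> integral {-h..0} (\<lambda>\<theta>. \<Pi>1 \<theta> *v \<phi> \<theta>))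
     + integral {-h..0} (\<lambda>\<theta>. integral {-h..0} (\<lambda>\<xi>. \<phi> \<xi> \<bullet> (\<Pi>2 \<xi> \<theta> *v \<phi> \<theta>)))"

end

theory Submission
  imports Defs
begin

text \<open>
  Exponential stability makes the whole state decay: every value that the state at time \<open>t\<close>
  takes is at most a constant multiple of \<open>exp (- \<sigma> t) \<parallel>\<phi>\<parallel>\<^sub>h\<close>. The
  running cost is quadratic in the state, so it decays like \<open>exp (- 2 \<sigma> t) \<parallel>\<phi>\<parallel>\<^sub>h\<^sup>2\<close>,
  and integrating gives the quadratic upper bound (\<open>cost_integral_le\<close>).

  For the lower bound it is enough to keep the term with \<open>Q\<close> on a short initial interval. The
  same decay bounds \<open>x'\<close>, so that over time \<open>t\<close> the solution moves by at most
  \<open>L t \<parallel>\<phi>\<parallel>\<^sub>h\<close>. When \<open>\<parallel>\<phi>\<parallel>\<^sub>h \<le> 1\<close>, it therefore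
  needs at least the time \<open>\<parallel>\<phi>(0)\<parallel> / (2 L)\<close> to lose half of its initial length. The time
  for which the running cost stays of order \<open>\<parallel>\<phi>(0)\<parallel>\<^sup>2\<close> is thus of order
  \<open>\<parallel>\<phi>(0)\<parallel>\<close>, and their product is the cube
  (\<open>cost_integral_ge_cube\<close>).

  Both arguments look only at the cost along a solution. What remains is to see that the
  closed-loop system in the form that the cost uses, with the control as a separate functional,
  has the same solutions as the system with the combined kernel \<open>E + D \<Gamma>\<^sub>1\<close>, to which
  stability refers. Splitting the integral needs each summand to be integrable, and this holds
  because the states along a solution are bounded and continuous off a finite set
  (\<open>kernel_state_integrable\<close>).
\<close>

section \<open>Matrix estimates\<close>

lemma norm_matrix_vector_le:
  fixes M :: "real^'n^'m"
  shows "norm (M *v x) \<le> norm M * norm x"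
proof -
  have "norm (M *v x) \<le> L2_set (\<lambda>i. norm (M $ i) * norm x) UNIV"
    unfolding norm_vec_def[of "M *v x"]
    by (rule L2_set_mono) (auto simp: matrix_vector_mul_component Cauchy_Schwarz_ineq2)
  also have "\<dots> = norm M * norm x"
    by (simp add: norm_vec_def[of M] L2_set_left_distrib)
  finally show ?thesis .
qed

lemma quadratic_form_le:
  fixes M :: "real^'n^'n"
  assumes "norm x \<le> b"
  shows "x \<bullet> (M *v x) \<le> norm M * b\<^sup>2"
proof -
  have b: "0 \<le> b" using assms norm_ge_zero order_trans by blast
  have "x \<bullet> (M *v x) \<le> norm x * norm (M *v x)" by (rule norm_cauchy_schwarz)
  also have "\<dots> \<le> b * (norm M * b)"
    using assms b norm_matrix_vector_le[of M x]
    by (intro mult_mono order_trans[OF norm_matrix_vector_le]) auto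
  finally show ?thesis by (simp add: power2_eq_square algebra_simps)
qed

lemma sym_pos_def_coercive:
  fixes M :: "real^'n^'n"
  assumes "sym_pos_def M"
  obtains l where "l > 0" "\<And>x. l * (norm x)\<^sup>2 \<le> x \<bullet> (M *v x)"
proof -
  have "continuous_on (sphere 0 1) (\<lambda>x::real^'n. x \<bullet> (M *v x))"
    by (intro continuous_intros matrix_vector_mult_linear_continuous_on)
  moreover have "sphere (0::real^'n) 1 \<noteq> {}" by simp
  ultimately obtain u :: "real^'n" where u: "u \<in> sphere 0 1"
    and min: "\<forall>y\<in>sphere 0 1. u \<bullet> (M *v u) \<le> y \<bullet> (M *v y)"
    using continuous_attains_inf[OF compact_sphere] by blast
  have "u \<noteq> 0" using u by auto
  then have "u \<bullet> (M *v u) > 0" using assms by (simp add: sym_pos_def_def)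
  moreover have "(u \<bullet> (M *v u)) * (norm x)\<^sup>2 \<le> x \<bullet> (M *v x)" for x
  proof (cases "x = 0")
    case False
    have "u \<bullet> (M *v u) \<le> (x /\<^sub>R norm x) \<bullet> (M *v (x /\<^sub>R norm x))"
      using min[rule_format, of "x /\<^sub>R norm x"] False by simp
    also have "\<dots> = (x \<bullet> (M *v x)) / (norm x)\<^sup>2"
      by (simp add: matrix_vector_mult_scaleR power2_eq_square divide_inverse)
    finally show ?thesis using False by (simp add: field_simps)
  qed simp
  ultimately show ?thesis using that by blast
qed

lemma sym_pos_def_nonneg:
  fixes M :: "real^'n^'n"
  assumes "sym_pos_def M"
  shows "0 \<le> x \<bullet> (M *v x)"
  using assms by (cases "x = 0") (auto simp: sym_pos_def_def intro: less_imp_le)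

lemma bilinear_vector_matrix: "bilinear (\<lambda>(x::real^'n) (M::real^'n^'m). M *v x)"
  by (auto simp: bilinear_def linear_iff matrix_vector_right_distrib matrix_vector_mult_scaleR
      matrix_vector_mult_add_rdistrib scaleR_matrix_vector_assoc)

section \<open>Piecewise continuous initial functions\<close>

text \<open>Near each point of \<open>[-h, 0]\<close> either continuity or the one-sided limits bound \<open>\<phi>\<close> off
  the exceptional set, whose finitely many arbitrary values are harmless. Compactness, here in the
  form of bisection, makes the bound global. Without it the supremum in \<open>norm_h\<close> would say
  nothing about \<open>\<phi>\<close>.\<close>

lemma PC_bounded:
  assumes "\<phi> \<in> PC h"
  shows "bounded (\<phi> ` {-h..0})"
proof (cases "-h \<le> 0")
  case True
  obtain S where S: "finite S" "continuous_on ({-h..0} - S) \<phi>"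
      "\<And>s. s \<in> S \<inter> {-h<..0} \<Longrightarrow> \<exists>l. (\<phi> \<longlongrightarrow> l) (at_left s)"
      "\<And>s. s \<in> S \<inter> {-h..<0} \<Longrightarrow> \<exists>l. (\<phi> \<longlongrightarrow> l) (at_right s)"
    using assms unfolding PC_def by blast
  have near: "\<exists>d>0. \<exists>K. \<forall>y\<in>T. y \<noteq> x \<and> dist y x < d \<longrightarrow> norm (\<phi> y) \<le> K"
    if "(\<phi> \<longlongrightarrow> l) (at x within T)" for l x T
  proof -
    have "\<forall>\<^sub>F y in at x within T. dist (\<phi> y) l < 1"
      using that by (rule tendstoD) simp
    then obtain d where "d > 0" "\<forall>y\<in>T. y \<noteq> x \<and> dist y x < d \<longrightarrow> dist (\<phi> y) l < 1"
      by (auto simp: eventually_at)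
    moreover have "norm (\<phi> y) \<le> norm l + 1" if "dist (\<phi> y) l < 1" for y
      using that norm_triangle_ineq2[of "\<phi> y" l] by (auto simp: dist_norm)
    ultimately show ?thesis by blast
  qed
  have local: "\<exists>d>0. \<exists>K. \<forall>y\<in>{-h..0} - S. dist y x < d \<longrightarrow> norm (\<phi> y) \<le> K"
    if x: "x \<in> {-h..0}" for x
  proof (cases "x \<in> S")
    case False
    then have "(\<phi> \<longlongrightarrow> \<phi> x) (at x within ({-h..0} - S))"
      using S(2) x by (auto simp: continuous_on_def)
    then obtain d K where "d > 0"
      "\<forall>y\<in>{-h..0} - S. y \<noteq> x \<and> dist y x < d \<longrightarrow> norm (\<phi> y) \<le> K" using near by meson
    then have "\<forall>y\<in>{-h..0} - S. dist y x < d \<longrightarrow> norm (\<phi> y) \<le> max K (norm (\<phi> x))"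
      by (metis max.cobounded2 max.coboundedI1)
    with \<open>d > 0\<close> show ?thesis by blast
  next
    case True
    have left: "\<exists>d>0. \<exists>K. \<forall>y\<in>{-h..<x}. dist y x < d \<longrightarrow> norm (\<phi> y) \<le> K"
    proof (cases "x = -h")
      case False
      then obtain l where "(\<phi> \<longlongrightarrow> l) (at_left x)" using S(3) x True by force
      from near[OF this] obtain d K
        where "d > 0" "\<forall>y\<in>{..<x}. y \<noteq> x \<and> dist y x < d \<longrightarrow> norm (\<phi> y) \<le> K"
        by blast
      then show ?thesis by (intro exI[of _ d] conjI exI[of _ K]) auto
    qed (auto intro: zero_less_one)
    have right: "\<exists>d>0. \<exists>K. \<forall>y\<in>{x<..0}. dist y x < d \<longrightarrow> norm (\<phi> y) \<le> K"
    proof (cases "x = 0")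
      case False
      then obtain l where "(\<phi> \<longlongrightarrow> l) (at_right x)" using S(4) x True by force
      from near[OF this] obtain d K
        where "d > 0" "\<forall>y\<in>{x<..}. y \<noteq> x \<and> dist y x < d \<longrightarrow> norm (\<phi> y) \<le> K"
        by blast
      then show ?thesis by (intro exI[of _ d] conjI exI[of _ K]) auto
    qed (auto intro: zero_less_one)
    obtain d1 K1 where 1: "d1 > 0" "\<forall>y\<in>{-h..<x}. dist y x < d1 \<longrightarrow> norm (\<phi> y) \<le> K1"
      using left by blast
    obtain d2 K2 where 2: "d2 > 0" "\<forall>y\<in>{x<..0}. dist y x < d2 \<longrightarrow> norm (\<phi> y) \<le> K2"
      using right by blast
    have "norm (\<phi> y) \<le> max K1 K2" if "y \<in> {-h..0} - S" "dist y x < min d1 d2" for y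
    proof (cases "y < x")
      case True
      then show ?thesis using 1 that by (auto intro: max.coboundedI1)
    next
      case False
      then have "y > x" using that \<open>x \<in> S\<close> by (metis DiffE linorder_neqE_linordered_idom)
      then show ?thesis using 2 that by (auto intro: max.coboundedI2)
    qed
    moreover have "min d1 d2 > 0" using 1 2 by simp
    ultimately show ?thesis by blast
  qed
  have "bounded (\<phi> ` ({-h..0} \<inter> {-h..0}))"
    using True
  proof (induction rule: Bolzano[where P = "\<lambda>a b. bounded (\<phi> ` ({a..b} \<inter> {-h..0}))"])
    case (trans a b c)
    then have "{a..c} \<inter> {-h..0} = ({a..b} \<inter> {-h..0}) \<union> ({b..c} \<inter> {-h..0})" by auto
    then show ?case using trans by (simp add: image_Un)
  next
    case (local x)
    then obtain d K where d: "d > 0"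
      and K: "\<forall>y\<in>{-h..0} - S. dist y x < d \<longrightarrow> norm (\<phi> y) \<le> K"
      using \<open>\<And>x. x \<in> {-h..0} \<Longrightarrow> _\<close>[of x] by auto
    have "bounded (\<phi> ` ({a..b} \<inter> {-h..0}))" if "a \<le> x \<and> x \<le> b \<and> b - a < d" for a b
    proof (rule bounded_subset)
      show "bounded (cball 0 K \<union> \<phi> ` S)"
        using S(1) by (simp add: finite_imp_bounded)
      have "dist y x < d" if "y \<in> {a..b}" for y
        using that \<open>a \<le> x \<and> x \<le> b \<and> b - a < d\<close> by (auto simp: dist_real_def)
      then have "\<phi> y \<in> cball 0 K \<union> \<phi> ` S" if "y \<in> {a..b} \<inter> {-h..0}" for y
        using K that by (cases "y \<in> S") auto
      then show "\<phi> ` ({a..b} \<inter> {-h..0}) \<subseteq> cball 0 K \<union> \<phi> ` S" by blast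
    qed
    with d show ?case by blast
  qed
  then show ?thesis by simp
qed simp

lemma norm_le_norm_h:
  assumes "\<phi> \<in> PC h" "\<theta> \<in> {-h..0}"
  shows "norm (\<phi> \<theta>) \<le> norm_h h \<phi>"
  unfolding norm_h_def
proof (rule cSUP_upper[OF assms(2)])
  show "bdd_above ((\<lambda>\<theta>. norm (\<phi> \<theta>)) ` {-h..0})"
    using PC_bounded[OF assms(1)] by (auto simp: bounded_iff bdd_above_def)
qed

section \<open>States along solutions\<close>

lemma solution_initial:
  assumes "is_solution h F \<phi> x" "\<theta> \<in> {-h..0}"
  shows "x \<theta> = \<phi> \<theta>"
  using assms by (simp add: is_solution_def)

lemma solution_continuous:
  assumes "is_solution h F \<phi> x"
  shows "continuous_on {0..} x"
  using assms by (simp add: is_solution_def)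

lemma solution_bounded:
  assumes "\<phi> \<in> PC h" "is_solution h F \<phi> x"
  shows "bounded (x ` {-h..T})"
proof (rule bounded_subset)
  have "compact (x ` {0..T})"
    by (intro compact_continuous_image compact_Icc
        continuous_on_subset[OF solution_continuous[OF assms(2)]]) auto
  then show "bounded (\<phi> ` {-h..0} \<union> x ` {0..T})"
    using PC_bounded[OF assms(1)] compact_imp_bounded by simp
  show "x ` {-h..T} \<subseteq> \<phi> ` {-h..0} \<union> x ` {0..T}"
  proof safe
    fix s assume "s \<in> {-h..T}" "x s \<notin> x ` {0..T}"
    then show "x s \<in> \<phi> ` {-h..0}"
      using solution_initial[OF assms(2)] by (cases "s \<le> 0") auto
  qed
qed

lemma solution_continuous_off_finite:
  assumes "\<phi> \<in> PC h" "is_solution h F \<phi> x"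
  obtains S where "finite S" "continuous_on ({-h..} - S) x"
proof -
  obtain N where N: "finite N" "continuous_on ({-h..0} - N) \<phi>"
    using assms(1) unfolding PC_def by blast
  note eq = solution_initial[OF assms(2)] and cont = solution_continuous[OF assms(2)]
  \<comment> \<open>The time 0 is exceptional, because the initial function may jump there.\<close>
  let ?L = "{-h..<0} - N" and ?R = "{0<..} \<inter> {-h..} - N"
  have split: "{-h..} - insert 0 N = ?L \<union> ?R" by auto
  have "?L = (?L \<union> ?R) \<inter> {..<0}" "?R = (?L \<union> ?R) \<inter> {0<..}" by auto
  then have op: "openin (top_of_set (?L \<union> ?R)) ?L" "openin (top_of_set (?L \<union> ?R)) ?R"
    by (metis open_lessThan openin_open_Int, metis open_greaterThan openin_open_Int)
  have "continuous_on ?L \<phi>" by (rule continuous_on_subset[OF N(2)]) auto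
  then have L: "continuous_on ?L x" by (rule continuous_on_eq) (use eq in auto)
  have R: "continuous_on ?R x" by (rule continuous_on_subset[OF cont]) auto
  have "continuous_on ({-h..} - insert 0 N) x"
    unfolding split by (rule continuous_on_Un_local_open[OF op L R])
  with N(1) show ?thesis by (intro that[of "insert 0 N"]) simp_all
qed

lemma continuous_off_finite_measurable:
  fixes f :: "real \<Rightarrow> real^'n"
  assumes "finite S" "continuous_on (T - S) f" "T \<in> sets lebesgue"
  shows "f \<in> borel_measurable (lebesgue_on T)"
proof (rule measurable_restrict_countable)
  show "countable (S \<inter> T)" using assms(1) by (simp add: countable_finite)
  have "T \<inter> - (S \<inter> T) = T - S" by auto
  moreover have "- (S \<inter> T) \<in> sets lebesgue"
    unfolding Compl_in_sets_lebesgue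
    using assms(1) by (intro negligible_imp_sets negligible_finite) simp
  ultimately have "restrict_space (lebesgue_on T) (- (S \<inter> T)) = lebesgue_on (T - S)"
    using assms(3) by (simp add: restrict_restrict_space del: Compl_Int)
  moreover have "T - S \<in> sets lebesgue"
    using assms(1,3) by (metis negligible_finite negligible_imp_sets sets.Diff)
  ultimately show "f \<in> borel_measurable (restrict_space (lebesgue_on T) (- (S \<inter> T)))"
    using continuous_imp_measurable_on_sets_lebesgue[OF assms(2)] by simp
  show "{s} \<in> sets (lebesgue_on T)" if "s \<in> S \<inter> T" for s
    using that assms(3) by (simp add: sets_restrict_space_iff)
qed simp

text \<open>A bounded measurable factor keeps an integrable kernel integrable; the translate of a
  solution is such a factor.\<close>

lemma kernel_state_integrable:
  fixes M :: "real \<Rightarrow> real^'n^'m" and x :: "real \<Rightarrow> real^'n"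
  assumes "\<phi> \<in> PC h" "is_solution h F \<phi> x" "t \<ge> 0"
    and M: "M absolutely_integrable_on {-h..0}"
  shows "(\<lambda>\<theta>. M \<theta> *v state h x t \<theta>) absolutely_integrable_on {-h..0}"
proof (rule absolutely_integrable_bounded_measurable_product[OF bilinear_vector_matrix _ _ _ M])
  obtain S where S: "finite S" "continuous_on ({-h..} - S) x"
    using solution_continuous_off_finite[OF assms(1,2)] .
  show "state h x t \<in> borel_measurable (lebesgue_on {-h..0})"
  proof (rule continuous_off_finite_measurable)
    show "finite ((\<lambda>s. s - t) ` S)" using S(1) by simp
    have "continuous_on ({-h..0} - (\<lambda>s. s - t) ` S) (\<lambda>\<theta>. x (t + \<theta>))"
    proof (rule continuous_on_compose2[OF S(2)])
      show "(+) t ` ({-h..0} - (\<lambda>s. s - t) ` S) \<subseteq> {-h..} - S"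
      proof safe
        fix \<theta> assume "t + \<theta> \<in> S" "\<theta> \<notin> (\<lambda>s. s - t) ` S"
        then show False by (metis add_diff_cancel_left' imageI)
      qed (use \<open>t \<ge> 0\<close> in auto)
    qed (intro continuous_intros)
    then show "continuous_on ({-h..0} - (\<lambda>s. s - t) ` S) (state h x t)"
      by (rule continuous_on_eq) (auto simp: state_def)
  qed simp
  have "state h x t ` {-h..0} \<subseteq> x ` {-h..t}"
    using \<open>t \<ge> 0\<close> by (auto simp: state_def)
  then show "bounded (state h x t ` {-h..0})"
    using solution_bounded[OF assms(1,2)] bounded_subset by blast
qed simp

section \<open>The two forms of the closed loop\<close>

lemma closed_loop_linear_control:
  fixes x :: "real \<Rightarrow> real^'n" and \<Gamma>1 :: "real \<Rightarrow> real^'n^'r"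
  assumes "\<phi> \<in> PC h" "is_solution h F \<phi> x" "t \<ge> 0"
    and E: "E absolutely_integrable_on {-h..0}" and \<Gamma>1: "\<Gamma>1 absolutely_integrable_on {-h..0}"
  shows "closed_loop h A B E D (linear_control h \<Gamma>0 \<Gamma>1) (state h x t) =
    delay_rhs h (A + D ** \<Gamma>0) B (\<lambda>\<theta>. E \<theta> + D ** \<Gamma>1 \<theta>) (state h x t)"
proof -
  let ?\<psi> = "state h x t"
  have iE: "(\<lambda>\<theta>. E \<theta> *v ?\<psi> \<theta>) integrable_on {-h..0}"
    and i\<Gamma>: "(\<lambda>\<theta>. \<Gamma>1 \<theta> *v ?\<psi> \<theta>) integrable_on {-h..0}"
    using kernel_state_integrable[OF assms(1-3)] E \<Gamma>1
    by (auto intro: set_lebesgue_integral_eq_integral)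
  have iD: "(\<lambda>\<theta>. D *v (\<Gamma>1 \<theta> *v ?\<psi> \<theta>)) integrable_on {-h..0}"
    "integral {-h..0} (\<lambda>\<theta>. D *v (\<Gamma>1 \<theta> *v ?\<psi> \<theta>)) =
      D *v integral {-h..0} (\<lambda>\<theta>. \<Gamma>1 \<theta> *v ?\<psi> \<theta>)"
    using integrable_linear[OF i\<Gamma> matrix_vector_mul_bounded_linear[of D]]
      integral_linear[OF i\<Gamma> matrix_vector_mul_bounded_linear[of D]] by (simp_all add: o_def)
  have "integral {-h..0} (\<lambda>\<theta>. (E \<theta> + D ** \<Gamma>1 \<theta>) *v ?\<psi> \<theta>) =
    integral {-h..0} (\<lambda>\<theta>. E \<theta> *v ?\<psi> \<theta>) +
      D *v integral {-h..0} (\<lambda>\<theta>. \<Gamma>1 \<theta> *v ?\<psi> \<theta>)"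
    using integral_add[OF iE iD(1)] iD(2)
    by (simp add: matrix_vector_mult_add_rdistrib matrix_vector_mul_assoc)
  then show ?thesis
    by (simp add: closed_loop_def delay_rhs_def linear_control_def matrix_vector_right_distrib
        matrix_vector_mult_add_rdistrib matrix_vector_mul_assoc add_ac)
qed

lemma is_solution_cong:
  assumes "is_solution h F \<phi> x" "\<And>t. t \<ge> 0 \<Longrightarrow> F (state h x t) = G (state h x t)"
  shows "is_solution h G \<phi> x"
proof -
  obtain S where "\<forall>T. finite (S \<inter> {0..T})"
    "\<forall>t\<in>{0..} - S. (x has_vector_derivative F (state h x t)) (at t within {0..})"
    using assms(1) unfolding is_solution_def by blast
  then have "\<exists>S. (\<forall>T. finite (S \<inter> {0..T})) \<and>
    (\<forall>t\<in>{0..} - S. (x has_vector_derivative G (state h x t)) (at t within {0..}))"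
    using assms(2) by (intro exI[of _ S]) simp
  then show ?thesis using assms(1) unfolding is_solution_def by blast
qed

section \<open>Bounds by the size of the state\<close>

lemma integral_norm_nonneg:
  fixes M :: "real \<Rightarrow> real^'n^'m"
  assumes "M absolutely_integrable_on S"
  shows "0 \<le> integral S (\<lambda>\<theta>. norm (M \<theta>))"
  using assms by (intro Henstock_Kurzweil_Integration.integral_nonneg)
    (auto simp: absolutely_integrable_on_def)

lemma kernel_integral_le:
  fixes M :: "real \<Rightarrow> real^'n^'m"
  assumes M: "M absolutely_integrable_on {-h..0}"
    and \<psi>: "\<And>\<theta>. \<theta> \<in> {-h..0} \<Longrightarrow> norm (\<psi> \<theta>) \<le> b" and "0 \<le> b"
  shows "norm (integral {-h..0} (\<lambda>\<theta>. M \<theta> *v \<psi> \<theta>)) \<le>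
    integral {-h..0} (\<lambda>\<theta>. norm (M \<theta>)) * b"
proof (cases "(\<lambda>\<theta>. M \<theta> *v \<psi> \<theta>) integrable_on {-h..0}")
  case True
  have i: "(\<lambda>\<theta>. norm (M \<theta>)) integrable_on {-h..0}"
    using M by (simp add: absolutely_integrable_on_def)
  have "norm (integral {-h..0} (\<lambda>\<theta>. M \<theta> *v \<psi> \<theta>)) \<le>
    integral {-h..0} (\<lambda>\<theta>. norm (M \<theta>) * b)"
    using True integrable_on_mult_left[OF i]
    by (rule integral_norm_bound_integral)
      (auto intro!: order_trans[OF norm_matrix_vector_le] mult_left_mono \<psi>)
  then show ?thesis by simp
next
  case False
  \<comment> \<open>The integral takes its default value zero.\<close>
  then show ?thesis
    using \<open>0 \<le> b\<close> integral_norm_nonneg[OF M] by (simp add: not_integrable_integral)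
qed

lemma linear_control_le:
  fixes \<Gamma>1 :: "real \<Rightarrow> real^'n^'r"
  assumes "h \<ge> 0" "\<Gamma>1 absolutely_integrable_on {-h..0}"
    and \<psi>: "\<And>\<theta>. \<theta> \<in> {-h..0} \<Longrightarrow> norm (\<psi> \<theta>) \<le> b"
  shows "norm (linear_control h \<Gamma>0 \<Gamma>1 \<psi>) \<le>
    (norm \<Gamma>0 + integral {-h..0} (\<lambda>\<theta>. norm (\<Gamma>1 \<theta>))) * b"
proof -
  have b: "norm (\<psi> 0) \<le> b" using \<psi> \<open>h \<ge> 0\<close> by simp
  then have "0 \<le> b" using norm_ge_zero order_trans by blast
  have "norm (\<Gamma>0 *v \<psi> 0) \<le> norm \<Gamma>0 * b"
    by (meson b mult_left_mono norm_ge_zero norm_matrix_vector_le order_trans)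
  moreover have "norm (integral {-h..0} (\<lambda>\<theta>. \<Gamma>1 \<theta> *v \<psi> \<theta>)) \<le>
      integral {-h..0} (\<lambda>\<theta>. norm (\<Gamma>1 \<theta>)) * b"
    by (rule kernel_integral_le[OF assms(2)]) (use \<psi> \<open>0 \<le> b\<close> in auto)
  ultimately show ?thesis
    unfolding linear_control_def distrib_right by (intro norm_triangle_mono)
qed

lemma delay_rhs_le:
  fixes G :: "real \<Rightarrow> real^'n^'n"
  assumes "h \<ge> 0" "G absolutely_integrable_on {-h..0}"
    and \<psi>: "\<And>\<theta>. \<theta> \<in> {-h..0} \<Longrightarrow> norm (\<psi> \<theta>) \<le> b"
  shows "norm (delay_rhs h A0 A1 G \<psi>) \<le>
    (norm A0 + norm A1 + integral {-h..0} (\<lambda>\<theta>. norm (G \<theta>))) * b"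
proof -
  have b: "norm (\<psi> 0) \<le> b" "norm (\<psi> (-h)) \<le> b" using \<psi> \<open>h \<ge> 0\<close> by simp_all
  then have "0 \<le> b" using norm_ge_zero order_trans by blast
  have "norm (A0 *v \<psi> 0) \<le> norm A0 * b" "norm (A1 *v \<psi> (-h)) \<le> norm A1 * b"
    by (meson b mult_left_mono norm_ge_zero norm_matrix_vector_le order_trans)+
  moreover have "norm (integral {-h..0} (\<lambda>\<theta>. G \<theta> *v \<psi> \<theta>)) \<le>
      integral {-h..0} (\<lambda>\<theta>. norm (G \<theta>)) * b"
    by (rule kernel_integral_le[OF assms(2)]) (use \<psi> \<open>0 \<le> b\<close> in auto)
  ultimately show ?thesis
    unfolding delay_rhs_def distrib_right by (intro norm_triangle_mono)
qed

text \<open>Stability bounds \<open>x(t)\<close> for \<open>t \<ge> 0\<close> only, but the state reaches back by \<open>h\<close>.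
  At a time \<open>s \<le> 0\<close> the factor \<open>exp (- \<sigma> s)\<close> is at least one, so the same exponential also
  dominates the initial function; shifting by \<open>h\<close> costs the factor \<open>exp (\<sigma> h)\<close>.\<close>

lemma state_decay:
  assumes "\<phi> \<in> PC h" "is_solution h F \<phi> x" "\<sigma> > 0" "h \<ge> 0"
    and decay: "\<And>t. t \<ge> 0 \<Longrightarrow> norm (x t) \<le> \<gamma> * exp (- \<sigma> * t) * norm_h h \<phi>"
    and "t \<ge> 0" "\<theta> \<in> {-h..0}"
  shows "norm (state h x t \<theta>) \<le> max 1 \<gamma> * exp (\<sigma> * h) * exp (- \<sigma> * t) * norm_h h \<phi>"
proof -
  have N: "0 \<le> norm_h h \<phi>"
    using \<open>h \<ge> 0\<close> by (intro order_trans[OF norm_ge_zero norm_le_norm_h[OF assms(1), of 0]]) simp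
  have "norm (x s) \<le> max 1 \<gamma> * exp (- \<sigma> * s) * norm_h h \<phi>" if "s \<ge> -h" for s
  proof (cases "s \<ge> 0")
    case True
    have "\<gamma> * exp (- \<sigma> * s) * norm_h h \<phi> \<le> max 1 \<gamma> * exp (- \<sigma> * s) * norm_h h \<phi>"
      using N by (intro mult_right_mono) auto
    then show ?thesis using decay[OF True] by linarith
  next
    case False
    then have "norm (x s) \<le> 1 * 1 * norm_h h \<phi>"
      using that solution_initial[OF assms(2), of s] norm_le_norm_h[OF assms(1), of s] by simp
    also have "\<dots> \<le> max 1 \<gamma> * exp (- \<sigma> * s) * norm_h h \<phi>"
      using N False \<open>\<sigma> > 0\<close> by (intro mult_mono) (auto simp: mult_le_0_iff)
    finally show ?thesis .
  qed
  from this[of "t + \<theta>"] have "norm (state h x t \<theta>) \<le>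
      max 1 \<gamma> * exp (- \<sigma> * (t + \<theta>)) * norm_h h \<phi>"
    using assms(6,7) by (simp add: state_def)
  also have "\<dots> \<le> max 1 \<gamma> * exp (\<sigma> * h - \<sigma> * t) * norm_h h \<phi>"
  proof -
    have "\<sigma> * (- h) \<le> \<sigma> * \<theta>" using assms(3,7) by (intro mult_left_mono) auto
    then have "- \<sigma> * (t + \<theta>) \<le> \<sigma> * h - \<sigma> * t" by (simp add: algebra_simps)
    then show ?thesis using N by (intro mult_right_mono mult_left_mono) auto
  qed
  also have "\<dots> = max 1 \<gamma> * exp (\<sigma> * h) * exp (- \<sigma> * t) * norm_h h \<phi>"
    by (simp add: exp_diff exp_minus field_simps)
  finally show ?thesis .
qed

lemma solution_displacement_le:
  fixes x :: "real \<Rightarrow> real^'n"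
  assumes "is_solution h F \<phi> x" "\<And>s. s \<ge> 0 \<Longrightarrow> norm (F (state h x s)) \<le> L" "t \<ge> 0"
  shows "norm (x t - x 0) \<le> L * t"
proof -
  obtain S where S: "\<And>T. finite (S \<inter> {0..T})"
    and d: "\<And>t. t \<in> {0..} - S \<Longrightarrow>
      (x has_vector_derivative F (state h x t)) (at t within {0..})"
    using assms(1) unfolding is_solution_def by blast
  have int: "((\<lambda>s. F (state h x s)) has_integral (x t - x 0)) {0..t}"
  proof (rule fundamental_theorem_of_calculus_interior_strong[OF S \<open>t \<ge> 0\<close>])
    show "continuous_on {0..t} x"
      by (rule continuous_on_subset[OF solution_continuous[OF assms(1)]]) auto
    fix s assume "s \<in> {0<..<t} - S \<inter> {0..t}"
    then have s: "s \<in> {0..} - S" "s \<in> interior {0..}" by auto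
    show "(x has_vector_derivative F (state h x s)) (at s)"
      using d[OF s(1)] unfolding at_within_interior[OF s(2)] .
  qed
  have "0 \<le> L" by (rule order_trans[OF norm_ge_zero assms(2)[OF order_refl]])
  then have "norm (x t - x 0) \<le> L * measure lborel {0..t}"
    by (rule has_integral_bound_real[OF _ finite.emptyI int]) (rule assms(2), simp)
  then show ?thesis using \<open>t \<ge> 0\<close> by simp
qed

section \<open>Bounds on the cost along one trajectory\<close>

lemma cost_integral_le:
  fixes Q :: "real^'n^'n" and R :: "real^'r^'r"
  assumes "h \<ge> 0" "\<sigma> > 0" "\<Gamma>1 absolutely_integrable_on {-h..0}"
    and int: "running_cost h Q R (linear_control h \<Gamma>0 \<Gamma>1) x integrable_on {0..}"
    and decay: "\<And>t \<theta>. t \<ge> 0 \<Longrightarrow> \<theta> \<in> {-h..0} \<Longrightarrow>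
      norm (state h x t \<theta>) \<le> \<beta> * exp (- \<sigma> * t) * N"
  shows "integral {0..} (running_cost h Q R (linear_control h \<Gamma>0 \<Gamma>1) x) \<le>
    (norm Q + norm R * (norm \<Gamma>0 + integral {-h..0} (\<lambda>\<theta>. norm (\<Gamma>1 \<theta>)))\<^sup>2) *
      \<beta>\<^sup>2 / (2 * \<sigma>) * N\<^sup>2"
proof -
  let ?u = "linear_control h \<Gamma>0 \<Gamma>1"
    and ?k = "norm \<Gamma>0 + integral {-h..0} (\<lambda>\<theta>. norm (\<Gamma>1 \<theta>))"
  let ?C = "(norm Q + norm R * ?k\<^sup>2) * \<beta>\<^sup>2 * N\<^sup>2"
  have point: "running_cost h Q R ?u x t \<le> ?C * exp (- (2 * \<sigma>) * t)" if "t \<in> {0..}" for t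
  proof -
    let ?b = "\<beta> * exp (- \<sigma> * t) * N"
    have "norm (x t) \<le> ?b"
      using decay[of t 0] that \<open>h \<ge> 0\<close> by (simp add: state_def)
    then have "x t \<bullet> (Q *v x t) \<le> norm Q * ?b\<^sup>2" by (rule quadratic_form_le)
    moreover have "norm (?u (state h x t)) \<le> ?k * ?b"
      using assms(1,3) decay that by (intro linear_control_le) auto
    then have "?u (state h x t) \<bullet> (R *v ?u (state h x t)) \<le> norm R * (?k * ?b)\<^sup>2"
      by (rule quadratic_form_le)
    ultimately have "running_cost h Q R ?u x t \<le> norm Q * ?b\<^sup>2 + norm R * (?k * ?b)\<^sup>2"
      unfolding running_cost_def by (rule add_mono)
    also have "\<dots> = (norm Q + norm R * ?k\<^sup>2) * ?b\<^sup>2"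
      by (simp only: power_mult_distrib[of ?k] distrib_right[of "norm Q"] mult.assoc)
    also have "?b\<^sup>2 = \<beta>\<^sup>2 * N\<^sup>2 * exp (- (2 * \<sigma>) * t)"
      by (simp add: power_mult_distrib mult.commute flip: exp_double)
    finally show ?thesis by (simp add: mult.assoc)
  qed
  have e: "((\<lambda>t. exp (- (2 * \<sigma>) * t)) has_integral 1 / (2 * \<sigma>)) {0..}"
    using has_integral_exp_minus_to_infinity[of "2 * \<sigma>" 0] \<open>\<sigma> > 0\<close> by simp
  have "integral {0..} (running_cost h Q R ?u x) \<le> ?C * (1 / (2 * \<sigma>))"
    by (rule has_integral_le[OF integrable_integral[OF int] has_integral_mult_right[OF e] point])
  then show ?thesis by (simp add: mult_ac)
qed

text \<open>Moving away from \<open>x 0\<close> by at most \<open>L * t\<close>, the trajectory keeps at least half of its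
  initial length up to the time \<open>norm (x 0) / (2 * L)\<close>, and until then the running cost is at
  least \<open>l * (norm (x 0))\<^sup>2 / 4\<close>.\<close>

lemma cost_integral_ge_cube:
  fixes Q :: "real^'n^'n" and R :: "real^'r^'r"
  assumes "L > 0" "l > 0"
    and Q: "\<And>v. l * (norm v)\<^sup>2 \<le> v \<bullet> (Q *v v)" and R: "sym_pos_def R"
    and int: "running_cost h Q R u x integrable_on {0..}"
    and speed: "\<And>t. t \<ge> 0 \<Longrightarrow> norm (x t - x 0) \<le> L * t"
  shows "l / (8 * L) * norm (x 0) ^ 3 \<le> integral {0..} (running_cost h Q R u x)"
proof -
  let ?\<tau> = "norm (x 0) / (2 * L)" and ?c = "l * (norm (x 0) / 2)\<^sup>2"
  have lower: "l * (norm (x t))\<^sup>2 \<le> running_cost h Q R u x t" for t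
    using Q[of "x t"] sym_pos_def_nonneg[OF R] by (simp add: running_cost_def add_increasing2)
  have sub: "running_cost h Q R u x integrable_on {0..?\<tau>}"
    by (rule integrable_on_subinterval[OF int]) auto
  have "?c \<le> running_cost h Q R u x t" if "t \<in> {0..?\<tau>}" for t
  proof -
    have "L * t \<le> norm (x 0) / 2" using that \<open>L > 0\<close> by (simp add: field_simps)
    then have "norm (x 0) / 2 \<le> norm (x t)"
      using speed[of t] that norm_triangle_ineq3[of "x t" "x 0"] by simp
    then have "?c \<le> l * (norm (x t))\<^sup>2"
      using \<open>l > 0\<close> by (intro mult_left_mono power_mono) auto
    then show ?thesis using lower[of t] by linarith
  qed
  then have "integral {0..?\<tau>} (\<lambda>_. ?c) \<le> integral {0..?\<tau>} (running_cost h Q R u x)"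
    using sub by (intro integral_le) auto
  also have "\<dots> \<le> integral {0..} (running_cost h Q R u x)"
  proof (rule integral_subset_le[OF _ sub int])
    show "\<forall>t\<in>{0..}. 0 \<le> running_cost h Q R u x t"
      using \<open>l > 0\<close> by (auto intro!: order_trans[OF _ lower])
  qed auto
  finally show ?thesis
    using \<open>L > 0\<close> by (simp add: power2_eq_square power3_eq_cube field_simps)
qed


theorem proposition3:
  fixes h :: real
    and A B Q :: "real^'n^'n" and D :: "real^'r^'n" and R :: "real^'r^'r"
    and E :: "real \<Rightarrow> real^'n^'n"
    and \<Gamma>0 :: "real^'n^'r" and \<Gamma>1 :: "real \<Rightarrow> real^'n^'r"
    and \<Pi>0 :: "real^'n^'n" and \<Pi>1 :: "real \<Rightarrow> real^'n^'n" and \<Pi>2 :: "real \<Rightarrow> real \<Rightarrow> real^'n^'n"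
    and V :: "(real \<Rightarrow> real^'n) \<Rightarrow> real"
  assumes "h > 0"
    and "CARD('r) \<le> CARD('n)"
    and "continuous_on {-h..0} E"
    and "sym_pos_def Q" and "sym_pos_def R"
    and "\<Gamma>1 absolutely_integrable_on {-h..0}"
    and "admissible h A B E D Q R (linear_control h \<Gamma>0 \<Gamma>1)"
    and "exponentially_stable h (delay_rhs h (A + D ** \<Gamma>0) B (\<lambda>\<theta>. E \<theta> + D ** \<Gamma>1 \<theta>))"
    and "sym_pos_def \<Pi>0"
    and "\<Pi>1 absolutely_integrable_on {-h..0}"
    and "(\<lambda>(\<xi>, \<theta>). \<Pi>2 \<xi> \<theta>) absolutely_integrable_on {-h..0} \<times> {-h..0}"
    and "\<And>\<xi> \<theta>. \<xi> \<in> {-h..0} \<Longrightarrow> \<theta> \<in> {-h..0} \<Longrightarrow> transpose (\<Pi>2 \<xi> \<theta>) = \<Pi>2 \<theta> \<xi>"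
    and "\<And>\<phi>. \<phi> \<in> PC h \<Longrightarrow> V \<phi> = cost h A B E D Q R \<phi> (linear_control h \<Gamma>0 \<Gamma>1)"
    and "\<And>\<phi>. \<phi> \<in> PC h \<Longrightarrow> V \<phi> = quadratic_functional h \<Pi>0 \<Pi>1 \<Pi>2 \<phi>"
  shows "(\<exists>C1>0. \<forall>\<phi>\<in>PC h. V \<phi> \<le> C1 * (norm_h h \<phi>)\<^sup>2) \<and>
         (\<exists>\<alpha>>0. \<exists>c>0. \<forall>\<phi>\<in>PC h. norm_h h \<phi> \<le> \<alpha> \<longrightarrow> V \<phi> \<ge> c * norm (\<phi> 0) ^ 3)"
proof -
  let ?u = "linear_control h \<Gamma>0 \<Gamma>1" and ?G = "\<lambda>\<theta>. E \<theta> + D ** \<Gamma>1 \<theta>"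
  let ?F = "closed_loop h A B E D ?u" and ?H = "delay_rhs h (A + D ** \<Gamma>0) B ?G"
  have E: "E absolutely_integrable_on {-h..0}"
    using assms(3) by (rule absolutely_integrable_continuous_real)
  have "bounded_linear (\<lambda>M::real^'n^'r. D ** M)"
    by (rule linear_conv_bounded_linear[THEN iffD1])
      (auto simp: linear_iff matrix_matrix_mult_def vec_eq_iff sum_distrib_left
        sum.distrib algebra_simps)
  then have "(\<lambda>\<theta>. D ** \<Gamma>1 \<theta>) absolutely_integrable_on {-h..0}"
    using absolutely_integrable_linear[OF assms(6)] by (force simp: o_def)
  then have G: "?G absolutely_integrable_on {-h..0}"
    using E by (intro set_integral_add)
  obtain \<gamma> \<sigma> where "\<sigma> > 0" and stable: "\<And>\<phi> x t. \<phi> \<in> PC h \<Longrightarrow> is_solution h ?H \<phi> x \<Longrightarrow>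
      t \<ge> 0 \<Longrightarrow> norm (x t) \<le> \<gamma> * exp (- \<sigma> * t) * norm_h h \<phi>"
    using assms(8) unfolding exponentially_stable_def by blast
  define \<beta> where "\<beta> = max 1 \<gamma> * exp (\<sigma> * h)"
  have "\<beta> > 0" by (simp add: \<beta>_def)

  define x where "x \<phi> = (SOME x. is_solution h ?F \<phi> x)" for \<phi>
  have sol: "is_solution h ?F \<phi> (x \<phi>)" if "\<phi> \<in> PC h" for \<phi>
    using assms(7) that unfolding admissible_def well_posed_def x_def by (metis someI_ex)
  have sol': "is_solution h ?H \<phi> (x \<phi>)" if "\<phi> \<in> PC h" for \<phi>
    using sol[OF that] closed_loop_linear_control[OF that sol[OF that] _ E assms(6)]
    by (rule is_solution_cong)
  have int: "running_cost h Q R ?u (x \<phi>) integrable_on {0..}" if "\<phi> \<in> PC h" for \<phi>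
    using assms(7) that sol[OF that] unfolding admissible_def by blast
  have V: "V \<phi> = integral {0..} (running_cost h Q R ?u (x \<phi>))" if "\<phi> \<in> PC h" for \<phi>
    using assms(13)[OF that] by (simp add: cost_def x_def)
  have decay: "norm (state h (x \<phi>) t \<theta>) \<le> \<beta> * exp (- \<sigma> * t) * norm_h h \<phi>"
    if "\<phi> \<in> PC h" "t \<ge> 0" "\<theta> \<in> {-h..0}" for \<phi> t \<theta>
    using state_decay[OF that(1) sol'[OF that(1)] \<open>\<sigma> > 0\<close> _ stable[OF that(1) sol'[OF that(1)]]
        that(2,3)] assms(1) by (simp add: \<beta>_def)

  let ?k = "norm \<Gamma>0 + integral {-h..0} (\<lambda>\<theta>. norm (\<Gamma>1 \<theta>))"
  let ?C = "(norm Q + norm R * ?k\<^sup>2) * \<beta>\<^sup>2 / (2 * \<sigma>)"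
  have "V \<phi> \<le> (?C + 1) * (norm_h h \<phi>)\<^sup>2" if "\<phi> \<in> PC h" for \<phi>
  proof -
    have "V \<phi> \<le> ?C * (norm_h h \<phi>)\<^sup>2"
      unfolding V[OF that] using assms(1) \<open>\<sigma> > 0\<close> assms(6) int[OF that] decay[OF that]
      by (intro cost_integral_le) auto
    then show ?thesis by (simp only: distrib_right) (simp add: add_increasing2)
  qed
  moreover have "?C + 1 > 0"
    using \<open>\<sigma> > 0\<close> by (intro add_nonneg_pos divide_nonneg_pos mult_nonneg_nonneg add_nonneg_nonneg) auto
  ultimately have upper: "\<exists>C1>0. \<forall>\<phi>\<in>PC h. V \<phi> \<le> C1 * (norm_h h \<phi>)\<^sup>2" by blast

  obtain l where "l > 0" and l: "\<And>v. l * (norm v)\<^sup>2 \<le> v \<bullet> (Q *v v)"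
    using sym_pos_def_coercive[OF assms(4)] by blast
  let ?g = "norm (A + D ** \<Gamma>0) + norm B + integral {-h..0} (\<lambda>\<theta>. norm (?G \<theta>))"
  have "?g \<ge> 0"
    using integral_norm_nonneg[OF G] by simp
  \<comment> \<open>Adding one keeps the speed bound positive even if the system is trivial.\<close>
  define L where "L = ?g * \<beta> + 1"
  have "L > 0" using \<open>?g \<ge> 0\<close> \<open>\<beta> > 0\<close> by (simp add: L_def add_nonneg_pos)
  have "l / (8 * L) * norm (\<phi> 0) ^ 3 \<le> V \<phi>" if \<phi>: "\<phi> \<in> PC h" "norm_h h \<phi> \<le> 1" for \<phi>
  proof -
    have "norm (?H (state h (x \<phi>) t)) \<le> L" if "t \<ge> 0" for t
    proof -
      have "norm (state h (x \<phi>) t \<theta>) \<le> \<beta>" if "\<theta> \<in> {-h..0}" for \<theta>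
      proof -
        have "norm (state h (x \<phi>) t \<theta>) \<le> \<beta> * exp (- \<sigma> * t) * norm_h h \<phi>"
          using decay \<phi>(1) \<open>t \<ge> 0\<close> that by blast
        also have "\<dots> \<le> \<beta> * exp (- \<sigma> * t) * 1"
          using \<phi>(2) \<open>\<beta> > 0\<close> by (intro mult_left_mono) auto
        also have "\<dots> \<le> \<beta>"
          using \<open>\<beta> > 0\<close> \<open>\<sigma> > 0\<close> \<open>t \<ge> 0\<close> by simp
        finally show ?thesis .
      qed
      then show ?thesis
        using delay_rhs_le[OF _ G, of "state h (x \<phi>) t" \<beta> "A + D ** \<Gamma>0" B] assms(1)
        by (simp add: L_def)
    qed
    then have "norm (x \<phi> t - x \<phi> 0) \<le> L * t" if "t \<ge> 0" for t
      using solution_displacement_le[OF sol'[OF \<phi>(1)]] that by blast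
    then have "l / (8 * L) * norm (x \<phi> 0) ^ 3 \<le> V \<phi>"
      unfolding V[OF \<phi>(1)]
      using cost_integral_ge_cube[OF \<open>L > 0\<close> \<open>l > 0\<close> l assms(5) int[OF \<phi>(1)]] by blast
    moreover have "x \<phi> 0 = \<phi> 0"
      using solution_initial[OF sol[OF \<phi>(1)], of 0] assms(1) by simp
    ultimately show ?thesis by simp
  qed
  moreover have "l / (8 * L) > 0" using \<open>l > 0\<close> \<open>L > 0\<close> by simp
  ultimately have "\<exists>\<alpha>>0. \<exists>c>0. \<forall>\<phi>\<in>PC h. norm_h h \<phi> \<le> \<alpha> \<longrightarrow> V \<phi> \<ge> c * norm (\<phi> 0) ^ 3"
    by (intro exI[of _ 1] conjI exI[of _ "l / (8 * L)"]) auto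
  with upper show ?thesis by blast
qed

end
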